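(* Let $\mathtt{k}>0$. The following results are true for the modified $\mathtt{k}$-Bessel functions. (a) If $\nu\ge\mu>-\mathtt{k}$, then the function $x\mapsto\mathcal{I}^{\mathtt{k}}_{\mu}(x)/\mathcal{I}^{\mathtt{k}}_{\nu}(x)$ is increasing on $\mathbb{R}$. (b) The function $\nu\mapsto\mathcal{I}^{\mathtt{k}}_{\nu+\mathtt{k}}(x)/\mathcal{I}^{\mathtt{k}}_{\nu}(x)$ is increasing on $(-\mathtt{k},\infty)$; that is, for $\nu\ge\mu>-\mathtt{k}$, the inequality $$\mathcal{I}^{\mathtt{k}}_{\nu+\mathtt{k}}(x)\,\mathcal{I}^{\mathtt{k}}_{\mu}(x)\ \ge\ \mathcal{I}^{\mathtt{k}}_{\nu}(x)\,\mathcal{I}^{\mathtt{k}}_{\mu+\mathtt{k}}(x)$$ holds for each fixed $x>0$ and $\mathtt{k}>0$. (c) The function $\nu\mapsto\mathcal{I}^{\mathtt{k}}_{\nu}(x)$ is decreasing and log-convex on $(-\mathtt{k},\infty)$ for each fixed $x>0$.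
   Context: For $\mathtt{k}>0$, the $\mathtt{k}$-gamma function is $\Gamma_{\mathtt{k}}(z)=\int_0^\infty t^{z-1}e^{-t^{\mathtt{k}}/\mathtt{k}}\,dt$ for $\operatorname{Re}(z)>0$; it satisfies $\Gamma_{\mathtt{k}}(z+\mathtt{k})=z\,\Gamma_{\mathtt{k}}(z)$. For $\nu>-\mathtt{k}$ the modified $\mathtt{k}$-Bessel function is $$\mathtt{I}^{\mathtt{k}}_{\nu}(x)=\sum_{r=0}^\infty\frac{1}{\Gamma_{\mathtt{k}}(r\mathtt{k}+\nu+\mathtt{k})\,r!}\left(\frac{x}{2}\right)^{2r+\frac{\nu}{\mathtt{k}}},$$ and its normalized form is $$\mathcal{I}^{\mathtt{k}}_{\nu}(x)=\left(\frac{2}{x}\right)^{\frac{\nu}{\mathtt{k}}}\Gamma_{\mathtt{k}}(\nu+\mathtt{k})\,\mathtt{I}^{\mathtt{k}}_{\nu}(x)=\sum_{r=0}^\infty\frac{\Gamma_{\mathtt{k}}(\nu+\mathtt{k})}{\Gamma_{\mathtt{k}}(r\mathtt{k}+\nu+\mathtt{k})\,4^r\,r!}\,x^{2r},$$ where the last power series defines $\mathcal{I}^{\mathtt{k}}_{\nu}(x)$ for all real $x$. A positive function is log-convex if its logarithm is convex.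
   Formalization: Part (a) is proved on [0,∞) instead of ℝ: the quotient is an even function of x, so it cannot increase on ℝ unless constant (for k=1, μ=0, ν=1 it equals 1 at x=0 and exceeds 1 at x=-1). *)

theory Defs
  imports "HOL-Analysis.Analysis"
begin

text \<open>
  The \<open>k\<close>-gamma function, restricted to real arguments (meaningful for \<open>k > 0\<close> and \<open>z > 0\<close>,
  where the integral converges).  The exponent \<open>k\<close> is real, hence \<open>powr\<close>; the value of the
  integrand at \<open>t = 0\<close>, where \<open>0 powr a = 0\<close>, is immaterial.
\<close>

definition k_Gamma :: "real \<Rightarrow> real \<Rightarrow> real" where
  "k_Gamma k z = integral {0..} (\<lambda>t. t powr (z - 1) * exp (- (t powr k / k)))"

text \<open>
  The normalized modified \<open>k\<close>-Bessel function
  \<open>(2 / x) powr (\<nu> / k) * \<Gamma>\<^sub>k (\<nu> + k) * I\<^sub>\<nu>\<^sup>k x\<close>, given for every real \<open>x\<close> by its power series.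
\<close>

definition nk_Bessel :: "real \<Rightarrow> real \<Rightarrow> real \<Rightarrow> real" where
  "nk_Bessel k \<nu> x =
     (\<Sum>r. k_Gamma k (\<nu> + k) / (k_Gamma k (real r * k + \<nu> + k) * 4 ^ r * fact r) * x ^ (2 * r))"

text \<open>
  Positivity is part of the notion, since \<open>ln\<close> is total.
\<close>

definition log_convex_on :: "real set \<Rightarrow> (real \<Rightarrow> real) \<Rightarrow> bool" where
  "log_convex_on S f \<longleftrightarrow> (\<forall>x\<in>S. f x > 0) \<and> convex_on S (\<lambda>x. ln (f x))"

end

theory Submission
  imports Defs
begin

text \<open>
  The functional equation \<open>\<Gamma>\<^sub>k (z + k) = z \<Gamma>\<^sub>k z\<close> turns the \<open>r\<close>-th coefficient of the normalized
  \<open>k\<close>-Bessel series into the elementary product of the numbers \<open>1 / (4 j (\<nu> + j k))\<close> for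
  \<open>1 \<le> j \<le> r\<close> (\<open>bessel_coeff_eq_k_Gamma\<close>).  Everything else is read off this product.

  For \<open>\<mu> \<le> \<nu>\<close> the quotient of the coefficients of order \<open>\<mu>\<close> and \<open>\<nu>\<close> gains the factor
  \<open>(\<nu> + j k) / (\<mu> + j k) \<ge> 1\<close> from index \<open>j - 1\<close> to \<open>j\<close>, so it increases with the index.  By the
  principle of Biernacki and Krzyz, a quotient of two power series whose coefficient quotients
  increase is itself increasing on the nonnegative half-line
  (\<open>suminf_mult_suminf_le_of_cross_le\<close>); this is the monotonicity in \<open>x\<close>.  The quotient is an even
  function of \<open>x\<close>, which is why the half-line is the right domain.

  The quotient of coefficients starts at 1 and increases, so the coefficients, and with them the
  normalized Bessel function, decrease in the order.  As functions of \<open>\<nu>\<close>, the factors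
  \<open>1 / (4 j (\<nu> + j k))\<close> are log-convex.  This property passes to products, and by Hoelder's
  inequality to convergent series (\<open>log_convex_on_suminf\<close>), hence to the normalized Bessel function.
  Finally, a convex function has increasing increments (\<open>convex_on_increments_mono\<close>);
  applied to the logarithm with increment \<open>k\<close>, this says that the quotient of the values at
  \<open>\<nu> + k\<close> and \<open>\<nu>\<close> increases with \<open>\<nu>\<close>.
\<close>

section \<open>The \<open>k\<close>-gamma function\<close>

text \<open>
  The substitution \<open>u = t powr k / k\<close> in Euler's integral for \<open>\<Gamma> (z / k)\<close>.  Through this identity,
  positivity and the functional equation are inherited from the classical gamma function.
\<close>

lemma k_Gamma_conv_Gamma:
  fixes k z :: real
  assumes "k > 0" "z > 0"
  shows "k_Gamma k z = k powr (z / k - 1) * Gamma (z / k)"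
proof -
  define s where "s = z / k"
  define f where "f = (\<lambda>u::real. u powr (s - 1) / exp u)"
  define g where "g = (\<lambda>t::real. t powr k / k)"
  have s: "s > 0" using assms by (simp add: s_def)
  have f_int: "(f has_integral Gamma s) {0<..}"
  proof (subst has_integral_spike_set_eq)
    show "(f has_integral Gamma s) {0..}"
      using Gamma_integral_real[OF s] by (simp add: f_def)
  qed (rule negligible_subset[of "{0}"]; auto)+
  have f_abs: "f absolutely_integrable_on {0<..}"
    by (rule nonnegative_absolutely_integrable_1)
       (use f_int in \<open>auto simp: f_def has_integral_integrable\<close>)
  have g_deriv: "(g has_real_derivative t powr (k - 1)) (at t within {0<..})"
    if "t \<in> {0<..}" for t
    using that assms unfolding g_def by (auto intro!: derivative_eq_intros)
  have g_inj: "inj_on g {0<..}"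
    by (rule inj_on_inverseI[of _ "\<lambda>u. (k * u) powr (1 / k)"])
       (use assms in \<open>simp add: g_def powr_powr\<close>)
  have g_image: "g ` {0<..} = {0<..}"
  proof (intro equalityI subsetI)
    fix u :: real assume u: "u \<in> {0<..}"
    have "u = g ((k * u) powr (1 / k))"
      using u assms by (simp add: g_def powr_powr)
    then show "u \<in> g ` {0<..}" using u assms by (intro image_eqI[where x = "(k * u) powr (1 / k)"]) auto
  qed (use assms in \<open>auto simp: g_def\<close>)
  have cov: "integral {0<..} (\<lambda>t. \<bar>t powr (k - 1)\<bar> * f (g t)) = Gamma s"
    using has_absolute_integral_change_of_variables_1'[of "{0<..}" g "\<lambda>t. t powr (k - 1)" f "Gamma s"]
      g_deriv g_inj f_abs integral_unique[OF f_int] by (simp add: g_image)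
  have "integral {0<..} (\<lambda>t. \<bar>t powr (k - 1)\<bar> * f (g t)) =
        integral {0<..} (\<lambda>t. k powr (1 - s) * (t powr (z - 1) * exp (- (t powr k / k))))"
  proof (rule integral_cong)
    fix t :: real assume t: "t \<in> {0<..}"
    have "t powr (k - 1) * (t powr k / k) powr (s - 1) = k powr (1 - s) * t powr (z - 1)"
    proof -
      have "k - 1 + k * (s - 1) = z - 1" using assms by (simp add: s_def algebra_simps)
      then have "t powr (z - 1) = t powr (k - 1) * t powr (k * (s - 1))"
        by (simp only: powr_add[symmetric])
      moreover have "(t powr k / k) powr (s - 1) = t powr (k * (s - 1)) / k powr (s - 1)"
        using assms by (simp add: powr_divide powr_powr)
      moreover have "k powr (1 - s) = 1 / k powr (s - 1)"
        using powr_minus_divide[of k "s - 1"] by simp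
      ultimately show ?thesis by simp
    qed
    then show "\<bar>t powr (k - 1)\<bar> * f (g t) =
        k powr (1 - s) * (t powr (z - 1) * exp (- (t powr k / k)))"
      by (simp add: f_def g_def exp_minus field_simps)
  qed
  also have "\<dots> = k powr (1 - s) * integral {0<..} (\<lambda>t. t powr (z - 1) * exp (- (t powr k / k)))"
    by (rule integral_mult_right)
  also have "integral {0<..} (\<lambda>t. t powr (z - 1) * exp (- (t powr k / k))) = k_Gamma k z"
    unfolding k_Gamma_def by (rule integral_spike_set; rule negligible_subset[of "{0}"]) auto
  finally have "k powr (1 - s) * k_Gamma k z = Gamma s" by (simp only: cov)
  moreover have "k powr (1 - s) = 1 / k powr (s - 1)"
    using powr_minus_divide[of k "s - 1"] by simp
  moreover have "k powr (s - 1) \<noteq> 0" using assms by simp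
  ultimately have "k_Gamma k z = k powr (s - 1) * Gamma s" by (simp add: field_simps)
  then show ?thesis by (simp only: s_def)
qed

lemma k_Gamma_pos:
  assumes "k > 0" "z > 0"
  shows "k_Gamma k z > 0"
  using assms by (simp add: k_Gamma_conv_Gamma)

lemma k_Gamma_add_k:
  assumes "k > 0" "z > 0"
  shows "k_Gamma k (z + k) = z * k_Gamma k z"
proof -
  have "z / k \<notin> \<int>\<^sub>\<le>\<^sub>0"
    using assms nonpos_Ints_nonpos[of "z / k"] by (meson divide_pos_pos not_le)
  then have "Gamma ((z + k) / k) = z / k * Gamma (z / k)"
    using assms Gamma_plus1[of "z / k"] by (simp add: add_divide_distrib)
  moreover have "k powr ((z + k) / k - 1) = k * k powr (z / k - 1)"
    using assms by (simp add: add_divide_distrib powr_diff)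
  ultimately show ?thesis using assms by (simp add: k_Gamma_conv_Gamma)
qed

section \<open>The coefficients of the normalized modified \<open>k\<close>-Bessel function\<close>

text \<open>
  Keeping the powers of 4 and the factorial inside the product makes every factor a reciprocal of an
  affine function of \<open>\<nu>\<close>.
\<close>

definition bessel_coeff :: "real \<Rightarrow> real \<Rightarrow> nat \<Rightarrow> real" where
  "bessel_coeff k \<nu> r = (\<Prod>j=1..r. 1 / (4 * real j * (\<nu> + real j * k)))"

lemma bessel_coeff_0 [simp]: "bessel_coeff k \<nu> 0 = 1"
  by (simp add: bessel_coeff_def)

lemma bessel_coeff_Suc:
  "bessel_coeff k \<nu> (Suc r) = bessel_coeff k \<nu> r / (4 * real (Suc r) * (\<nu> + real (Suc r) * k))"
  by (simp add: bessel_coeff_def)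

lemma shifted_index_pos:
  fixes k \<nu> :: real
  assumes "k > 0" "\<nu> > - k" "j \<ge> 1"
  shows "\<nu> + real j * k > 0"
proof -
  have "k \<le> real j * k" using assms by simp
  then show ?thesis using assms(2) by linarith
qed

lemma bessel_coeff_pos:
  assumes "k > 0" "\<nu> > - k"
  shows "bessel_coeff k \<nu> r > 0"
  unfolding bessel_coeff_def using shifted_index_pos[OF assms]
  by (intro prod_pos) simp

lemma bessel_coeff_eq_k_Gamma:
  assumes "k > 0" "\<nu> > - k"
  shows "k_Gamma k (\<nu> + k) / (k_Gamma k (real r * k + \<nu> + k) * 4 ^ r * fact r) = bessel_coeff k \<nu> r"
proof (induction r)
  case 0
  have "k_Gamma k (\<nu> + k) > 0" using assms by (intro k_Gamma_pos) auto
  then show ?case by simp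
next
  case (Suc r)
  have pos: "real r * k + \<nu> + k > 0"
    using shifted_index_pos[OF assms, of "Suc r"] by (simp add: algebra_simps)
  have "k_Gamma k (real (Suc r) * k + \<nu> + k) = (\<nu> + real (Suc r) * k) * k_Gamma k (real r * k + \<nu> + k)"
    using k_Gamma_add_k[OF assms(1) pos] by (simp add: algebra_simps)
  then show ?case
    unfolding bessel_coeff_Suc Suc.IH[symmetric] by (simp add: mult_ac)
qed

lemma nk_Bessel_eq_suminf:
  assumes "k > 0" "\<nu> > - k"
  shows "nk_Bessel k \<nu> x = (\<Sum>r. bessel_coeff k \<nu> r * x ^ (2 * r))"
  using assms by (simp add: nk_Bessel_def bessel_coeff_eq_k_Gamma)

text \<open>
  Replacing each \<open>\<nu> + j k\<close> by \<open>\<nu> + k\<close>, the smallest of these factors, leaves the coefficients of an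
  exponential series, which then dominates the Bessel series.
\<close>

lemma bessel_coeff_le:
  assumes "k > 0" "\<nu> > - k"
  shows "bessel_coeff k \<nu> r \<le> inverse (fact r) * (1 / (4 * (\<nu> + k))) ^ r"
proof -
  have "bessel_coeff k \<nu> r \<le> (\<Prod>j=1..r. inverse (real j) * (1 / (4 * (\<nu> + k))))"
    unfolding bessel_coeff_def
  proof (intro prod_mono conjI)
    fix j assume j: "j \<in> {1..r}"
    have "k \<le> real j * k" using j assms by simp
    then have "4 * real j * (\<nu> + k) \<le> 4 * real j * (\<nu> + real j * k)"
      by (intro mult_left_mono) auto
    then have "1 / (4 * real j * (\<nu> + real j * k)) \<le> 1 / (4 * real j * (\<nu> + k))"
      using j assms by (intro divide_left_mono) (auto simp: shifted_index_pos)
    then show "1 / (4 * real j * (\<nu> + real j * k)) \<le> inverse (real j) * (1 / (4 * (\<nu> + k)))"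
      by (simp add: field_simps)
    show "0 \<le> 1 / (4 * real j * (\<nu> + real j * k))"
      using j shifted_index_pos[OF assms, of j] by simp
  qed
  also have "\<dots> = inverse (fact r) * (1 / (4 * (\<nu> + k))) ^ r"
    by (simp only: prod.distrib prod_constant fact_prod prod_inversef[symmetric] of_nat_prod card_atLeastAtMost) simp
  finally show ?thesis .
qed

lemma summable_bessel:
  assumes "k > 0" "\<nu> > - k"
  shows "summable (\<lambda>r. bessel_coeff k \<nu> r * x ^ (2 * r))"
proof (rule summable_comparison_test')
  let ?y = "1 / (4 * (\<nu> + k)) * x\<^sup>2"
  show "summable (\<lambda>r. inverse (fact r) * ?y ^ r)" by (rule summable_exp)
  fix r
  have "norm (bessel_coeff k \<nu> r * x ^ (2 * r)) = bessel_coeff k \<nu> r * (x\<^sup>2) ^ r"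
    using bessel_coeff_pos[OF assms, of r] by (simp add: power_mult abs_mult)
  also have "\<dots> \<le> (inverse (fact r) * (1 / (4 * (\<nu> + k))) ^ r) * (x\<^sup>2) ^ r"
    by (intro mult_right_mono bessel_coeff_le assms) simp
  finally show "norm (bessel_coeff k \<nu> r * x ^ (2 * r)) \<le> inverse (fact r) * ?y ^ r"
    by (simp only: power_mult_distrib mult.assoc)
qed

lemma nk_Bessel_pos:
  assumes "k > 0" "\<nu> > - k"
  shows "nk_Bessel k \<nu> x > 0"
  unfolding nk_Bessel_eq_suminf[OF assms]
proof (rule suminf_pos2[where i = 0, OF summable_bessel[OF assms]])
  show "0 \<le> bessel_coeff k \<nu> r * x ^ (2 * r)" for r
    using bessel_coeff_pos[OF assms, of r] by simp
qed simp

section \<open>Monotone quotients of series\<close>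

text \<open>
  By the Binet--Cauchy identity, twice the difference of the two sides is the double sum of the
  products \<open>(a n * b m - a m * b n) * (q n * p m - q m * p n)\<close>.  By the two
  hypotheses both factors are nonnegative for \<open>m \<le> n\<close> and nonpositive for \<open>n \<le> m\<close>, so no term is
  negative.
\<close>

lemma sum_mult_sum_le_of_cross_le:
  fixes a b p q :: "nat \<Rightarrow> real"
  assumes ab: "\<And>m n. m \<le> n \<Longrightarrow> a m * b n \<le> a n * b m"
    and pq: "\<And>m n. m \<le> n \<Longrightarrow> p n * q m \<le> p m * q n"
  shows "(\<Sum>n<N. a n * p n) * (\<Sum>n<N. b n * q n) \<le> (\<Sum>n<N. a n * q n) * (\<Sum>n<N. b n * p n)"
proof -
  have "0 \<le> (\<Sum>m<N. \<Sum>n<N. (a n * b m - a m * b n) * (q n * p m - q m * p n))"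
  proof (intro sum_nonneg)
    fix m n
    show "0 \<le> (a n * b m - a m * b n) * (q n * p m - q m * p n)"
      using ab[of m n] ab[of n m] pq[of m n] pq[of n m]
      by (cases "m \<le> n") (auto intro!: mult_nonneg_nonneg mult_nonpos_nonpos simp: mult.commute)
  qed
  also have "\<dots> = (\<Sum>m<N. \<Sum>n<N. (b m * p m) * (a n * q n)) + (\<Sum>m<N. \<Sum>n<N. (a m * q m) * (b n * p n))
      - (\<Sum>m<N. \<Sum>n<N. (b m * q m) * (a n * p n)) - (\<Sum>m<N. \<Sum>n<N. (a m * p m) * (b n * q n))"
    by (simp only: sum.distrib[symmetric] sum_subtractf[symmetric])
       (intro sum.cong refl, simp add: algebra_simps)
  also have "\<dots> = 2 * ((\<Sum>n<N. a n * q n) * (\<Sum>n<N. b n * p n)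
      - (\<Sum>n<N. a n * p n) * (\<Sum>n<N. b n * q n))"
    unfolding sum_product[symmetric] by simp
  finally show ?thesis by simp
qed

text \<open>
  Working with partial sums first keeps the symmetrization finite, so that no double series has to
  be rearranged.  For \<open>p n = x ^ n\<close> and \<open>q n = y ^ n\<close> with \<open>0 \<le> x \<le> y\<close> this is the monotonicity
  criterion for quotients of power series.
\<close>

lemma suminf_mult_suminf_le_of_cross_le:
  fixes a b p q :: "nat \<Rightarrow> real"
  assumes "\<And>m n. m \<le> n \<Longrightarrow> a m * b n \<le> a n * b m"
    and "\<And>m n. m \<le> n \<Longrightarrow> p n * q m \<le> p m * q n"
    and summable: "summable (\<lambda>n. a n * p n)" "summable (\<lambda>n. b n * q n)"
      "summable (\<lambda>n. a n * q n)" "summable (\<lambda>n. b n * p n)"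
  shows "(\<Sum>n. a n * p n) * (\<Sum>n. b n * q n) \<le> (\<Sum>n. a n * q n) * (\<Sum>n. b n * p n)"
  by (rule LIMSEQ_le[OF tendsto_mult[OF summable_LIMSEQ summable_LIMSEQ]
        tendsto_mult[OF summable_LIMSEQ summable_LIMSEQ]])
     (use assms sum_mult_sum_le_of_cross_le[of a b p q] in auto)

text \<open>
  The quotient of the coefficients of order \<open>\<mu>\<close> and \<open>\<nu>\<close> increases with the index, here with the
  denominators cleared.
\<close>

lemma bessel_coeff_cross_le:
  assumes "k > 0" "\<mu> > - k" "\<mu> \<le> \<nu>" "m \<le> n"
  shows "bessel_coeff k \<mu> m * bessel_coeff k \<nu> n \<le> bessel_coeff k \<mu> n * bessel_coeff k \<nu> m"
proof -
  have \<nu>: "\<nu> > - k" using assms by linarith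
  have "bessel_coeff k \<mu> m / bessel_coeff k \<nu> m \<le> bessel_coeff k \<mu> n / bessel_coeff k \<nu> n"
  proof (rule lift_Suc_mono_le[OF _ \<open>m \<le> n\<close>])
    fix r
    define A where "A = bessel_coeff k \<mu> r / bessel_coeff k \<nu> r"
    have "\<mu> + real (Suc r) * k > 0" using assms by (intro shifted_index_pos) auto
    then have "1 \<le> (\<nu> + real (Suc r) * k) / (\<mu> + real (Suc r) * k)" using assms by simp
    moreover have "A > 0"
      unfolding A_def using assms \<nu> by (simp add: bessel_coeff_pos)
    ultimately have "A * 1 \<le> A * ((\<nu> + real (Suc r) * k) / (\<mu> + real (Suc r) * k))"
      by (intro mult_left_mono) auto
    also have "\<dots> = bessel_coeff k \<mu> (Suc r) / bessel_coeff k \<nu> (Suc r)"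
      by (simp add: A_def bessel_coeff_Suc)
    finally show "bessel_coeff k \<mu> r / bessel_coeff k \<nu> r
        \<le> bessel_coeff k \<mu> (Suc r) / bessel_coeff k \<nu> (Suc r)" by (simp add: A_def)
  qed
  then show ?thesis
    using assms(1) \<nu> by (simp add: bessel_coeff_pos divide_simps mult_ac)
qed

lemma mono_on_nk_Bessel_quotient:
  assumes "k > 0" "\<mu> > - k" "\<mu> \<le> \<nu>"
  shows "mono_on {0..} (\<lambda>x. nk_Bessel k \<mu> x / nk_Bessel k \<nu> x)"
proof (rule mono_onI)
  fix x y :: real
  assume "x \<in> {0..}" "y \<in> {0..}" and xy: "x \<le> y"
  then have x: "0 \<le> x" and y: "0 \<le> y" by auto
  have \<nu>: "\<nu> > - k" using assms by linarith
  have powers: "x ^ (2 * n) * y ^ (2 * m) \<le> x ^ (2 * m) * y ^ (2 * n)" if "m \<le> n" for m n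
  proof -
    obtain d where n: "n = m + d" using le_Suc_ex[OF \<open>m \<le> n\<close>] by blast
    \<comment> \<open>The common factor \<open>(x * y) ^ (2 * m)\<close> splits off, leaving \<open>x ^ (2 * d) \<le> y ^ (2 * d)\<close>.\<close>
    have "x ^ (2 * d) * (x * y) ^ (2 * m) \<le> y ^ (2 * d) * (x * y) ^ (2 * m)"
      using x xy by (intro mult_right_mono power_mono) auto
    then show ?thesis by (simp add: n power_add power_mult_distrib mult_ac)
  qed
  have "nk_Bessel k \<mu> x * nk_Bessel k \<nu> y \<le> nk_Bessel k \<mu> y * nk_Bessel k \<nu> x"
    unfolding nk_Bessel_eq_suminf[OF assms(1,2)] nk_Bessel_eq_suminf[OF assms(1) \<nu>]
    by (intro suminf_mult_suminf_le_of_cross_le bessel_coeff_cross_le powers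
        summable_bessel assms \<nu>)
  then show "nk_Bessel k \<mu> x / nk_Bessel k \<nu> x \<le> nk_Bessel k \<mu> y / nk_Bessel k \<nu> y"
    using nk_Bessel_pos[OF assms(1) \<nu>] by (simp add: divide_simps mult_ac)
qed

section \<open>Log-convex functions\<close>

lemma convex_on_cong:
  assumes "\<And>x. x \<in> S \<Longrightarrow> f x = g x"
  shows "convex_on S f \<longleftrightarrow> convex_on S g"
  unfolding convex_on_def using assms by (auto simp: convex_def)

lemma log_convex_on_cong:
  assumes "\<And>x. x \<in> S \<Longrightarrow> f x = g x"
  shows "log_convex_on S f \<longleftrightarrow> log_convex_on S g"
  unfolding log_convex_on_def using assms by (auto cong: convex_on_cong)

text \<open>
  The multiplicative form of log-convexity: it is free of logarithms and therefore suits sums.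
\<close>

lemma log_convex_on_iff:
  assumes "convex S"
  shows "log_convex_on S f \<longleftrightarrow> (\<forall>x\<in>S. f x > 0) \<and>
    (\<forall>x\<in>S. \<forall>y\<in>S. \<forall>u\<ge>0. \<forall>v\<ge>0. u + v = 1 \<longrightarrow> f (u * x + v * y) \<le> f x powr u * f y powr v)"
proof -
  have "ln (f (u * x + v * y)) \<le> u * ln (f x) + v * ln (f y) \<longleftrightarrow>
      f (u * x + v * y) \<le> f x powr u * f y powr v"
    if pos: "\<forall>x\<in>S. f x > 0" and "x \<in> S" "y \<in> S" "u \<ge> 0" "v \<ge> 0" "u + v = 1" for x y u v
  proof -
    have "u * x + v * y \<in> S" using convexD[OF assms] that by fastforce
    then have "f x > 0" "f y > 0" "f (u * x + v * y) > 0" using pos that by auto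
    moreover from this have "ln (f x powr u * f y powr v) = u * ln (f x) + v * ln (f y)"
      by (simp add: ln_mult ln_powr)
    ultimately show ?thesis
      using ln_le_cancel_iff[of "f (u * x + v * y)" "f x powr u * f y powr v"] by simp
  qed
  then show ?thesis
    using assms unfolding log_convex_on_def convex_on_def by auto
qed

lemma log_convex_on_const:
  assumes "convex S" "c > 0"
  shows "log_convex_on S (\<lambda>_. c)"
  using assms unfolding log_convex_on_def by (simp add: convex_on_def distrib_right[symmetric])

lemma log_convex_on_mult:
  assumes "log_convex_on S f" "log_convex_on S g"
  shows "log_convex_on S (\<lambda>x. f x * g x)"
proof -
  have pos: "f x > 0" "g x > 0" if "x \<in> S" for x
    using that assms by (auto simp: log_convex_on_def)
  have "convex_on S (\<lambda>x. ln (f x) + ln (g x))"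
    using assms by (auto simp: log_convex_on_def)
  then have "convex_on S (\<lambda>x. ln (f x * g x))"
    by (rule convex_on_cong[THEN iffD1, rotated]) (use pos in \<open>simp add: ln_mult less_imp_neq[symmetric]\<close>)
  then show ?thesis using pos by (simp add: log_convex_on_def)
qed

lemma log_convex_on_prod:
  assumes "convex S" "finite A" "\<And>i. i \<in> A \<Longrightarrow> log_convex_on S (f i)"
  shows "log_convex_on S (\<lambda>x. \<Prod>i\<in>A. f i x)"
  using assms(2,3)
  by (induction A rule: finite_induct)
     (auto intro: log_convex_on_const log_convex_on_mult assms(1))

text \<open>
  This is the weighted inequality between arithmetic and geometric means for the two values of
  \<open>b * (x + a)\<close>, after taking reciprocals.
\<close>

lemma log_convex_on_inverse_affine:
  fixes a b :: real
  assumes "convex S" "\<And>x. x \<in> S \<Longrightarrow> b * (x + a) > 0"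
  shows "log_convex_on S (\<lambda>x. 1 / (b * (x + a)))"
  unfolding log_convex_on_iff[OF assms(1)]
proof (intro conjI ballI allI impI)
  show "1 / (b * (x + a)) > 0" if "x \<in> S" for x using assms(2)[OF that] by simp
next
  fix x y u v :: real
  assume xy: "x \<in> S" "y \<in> S" and uv: "0 \<le> u" "0 \<le> v" "u + v = 1"
  note pos = xy[THEN assms(2)]
  define P Q R where "P = b * (x + a)" and "Q = b * (y + a)" and "R = b * (u * x + v * y + a)"
  have PQ: "P > 0" "Q > 0" using pos by (auto simp: P_def Q_def)
  have "u * P + v * Q = b * (u * x + v * y + (u + v) * a)"
    by (simp add: P_def Q_def algebra_simps)
  then have "P powr u * Q powr v \<le> R"
    using Youngs_inequality_0[OF uv PQ] by (simp add: uv R_def)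
  moreover have "0 < P powr u * Q powr v" using PQ by simp
  ultimately have "1 / R \<le> 1 / (P powr u * Q powr v)" by (intro divide_left_mono) auto
  also have "\<dots> = (1 / P) powr u * (1 / Q) powr v"
    using PQ by (simp add: powr_divide)
  finally show "1 / (b * (u * x + v * y + a)) \<le> (1 / (b * (x + a))) powr u * (1 / (b * (y + a))) powr v"
    by (simp only: P_def Q_def R_def)
qed

text \<open>
  This amounts to Hoelder's inequality for series.  Once the summands at the two points are divided
  by their totals \<open>A\<close> and \<open>B\<close>, Young's inequality bounds the mixed terms by a convex combination of
  two series with sum 1.
\<close>

lemma log_convex_on_suminf:
  assumes "convex S" and lc: "\<And>r. log_convex_on S (f r)"
    and summable: "\<And>x. x \<in> S \<Longrightarrow> summable (\<lambda>r. f r x)"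
  shows "log_convex_on S (\<lambda>x. \<Sum>r. f r x)"
  unfolding log_convex_on_iff[OF assms(1)]
proof (intro conjI ballI allI impI)
  have pos: "f r x > 0" if "x \<in> S" for r x using lc that by (auto simp: log_convex_on_def)
  show sum_pos: "(\<Sum>r. f r x) > 0" if "x \<in> S" for x
    using suminf_pos[OF summable[OF that]] pos[OF that] by simp
  fix x y u v :: real
  assume xy: "x \<in> S" "y \<in> S" and uv: "0 \<le> u" "0 \<le> v" "u + v = 1"
  define A B where "A = (\<Sum>r. f r x)" and "B = (\<Sum>r. f r y)"
  define C where "C = A powr u * B powr v"
  have AB: "A > 0" "B > 0" using sum_pos xy by (auto simp: A_def B_def)
  have mem: "u * x + v * y \<in> S" using convexD[OF assms(1) xy uv] by simp
  have bound: "f r (u * x + v * y) \<le> C * (u * (f r x / A) + v * (f r y / B))" for r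
  proof -
    have "f r (u * x + v * y) \<le> f r x powr u * f r y powr v"
      using lc[of r] xy uv unfolding log_convex_on_iff[OF assms(1)] by blast
    also have "\<dots> = C * ((f r x / A) powr u * (f r y / B) powr v)"
      using AB by (simp add: C_def powr_divide)
    also have "\<dots> \<le> C * (u * (f r x / A) + v * (f r y / B))"
      using AB pos xy uv by (intro mult_left_mono Youngs_inequality_0) (auto simp: C_def)
    finally show ?thesis .
  qed
  have "(\<lambda>r. C * (u * (f r x / A) + v * (f r y / B))) sums (C * (u * (A / A) + v * (B / B)))"
    unfolding A_def B_def using xy summable
    by (intro sums_mult sums_add sums_divide summable_sums) auto
  then have sums: "(\<lambda>r. C * (u * (f r x / A) + v * (f r y / B))) sums C" using AB uv by simp
  have "(\<Sum>r. f r (u * x + v * y)) \<le> (\<Sum>r. C * (u * (f r x / A) + v * (f r y / B)))"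
    by (intro suminf_le bound summable mem sums_summable[OF sums])
  also have "\<dots> = C" by (rule sums_unique[OF sums, symmetric])
  finally have "(\<Sum>r. f r (u * x + v * y)) \<le> C" .
  then show "(\<Sum>r. f r (u * x + v * y)) \<le> (\<Sum>r. f r x) powr u * (\<Sum>r. f r y) powr v"
    by (simp add: C_def A_def B_def)
qed

text \<open>
  The points \<open>x + h\<close> and \<open>y\<close> lie between \<open>x\<close> and \<open>y + h\<close> and are mirror images about the midpoint,
  so they are convex combinations with exchanged weights; adding the two convexity inequalities
  makes the weights cancel.
\<close>

lemma convex_on_increments_mono:
  fixes f :: "real \<Rightarrow> real"
  assumes f: "convex_on S f" and "x \<in> S" "y + h \<in> S" "x \<le> y" "h \<ge> 0"
  shows "f (x + h) + f y \<le> f x + f (y + h)"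
proof (cases "y + h = x")
  case True
  then show ?thesis using assms by auto
next
  case False
  \<comment> \<open>\<open>t\<close> is the relative position of \<open>x + h\<close> in the interval from \<open>x\<close> to \<open>y + h\<close>.\<close>
  define w where "w = y + h - x"
  define t where "t = h / w"
  have w: "w > 0" using False assms by (simp add: w_def)
  have t: "0 \<le> t" "t \<le> 1" using w assms by (auto simp: t_def w_def)
  have "t * w = h" using w by (simp add: t_def)
  then have "x + h = (1 - t) *\<^sub>R x + t *\<^sub>R (y + h)"
    and "y = (1 - (1 - t)) *\<^sub>R x + (1 - t) *\<^sub>R (y + h)"
    by (auto simp: w_def algebra_simps)
  then have "f (x + h) \<le> (1 - t) * f x + t * f (y + h)"
    and "f y \<le> (1 - (1 - t)) * f x + (1 - t) * f (y + h)"
    using convex_onD[OF f, of t x "y + h"] convex_onD[OF f, of "1 - t" x "y + h"] t assms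
    by simp_all
  then show ?thesis by (simp add: algebra_simps)
qed

section \<open>Dependence on the order\<close>

text \<open>
  The coefficients decrease in the order: this is the case \<open>m = 0\<close> of \<open>bessel_coeff_cross_le\<close>,
  because all coefficients of index 0 equal 1.
\<close>

lemma antimono_on_nk_Bessel:
  assumes "k > 0"
  shows "antimono_on {- k<..} (\<lambda>\<nu>. nk_Bessel k \<nu> x)"
proof (rule monotone_onI)
  fix \<mu> \<nu> :: real
  assume "\<mu> \<in> {- k<..}" "\<nu> \<in> {- k<..}" and le: "\<mu> \<le> \<nu>"
  then have \<mu>: "\<mu> > - k" and \<nu>: "\<nu> > - k" by auto
  have coeff: "bessel_coeff k \<nu> r \<le> bessel_coeff k \<mu> r" for r
    using bessel_coeff_cross_le[OF assms \<mu> le, of 0 r] by simp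
  show "nk_Bessel k \<mu> x \<ge> nk_Bessel k \<nu> x"
    unfolding nk_Bessel_eq_suminf[OF assms \<mu>] nk_Bessel_eq_suminf[OF assms \<nu>]
    by (intro suminf_le mult_right_mono coeff summable_bessel assms \<mu> \<nu>) simp
qed

text \<open>
  The point 0 is excluded because the terms \<open>x ^ (2 * r)\<close> with \<open>r > 0\<close> vanish there, and log-convexity
  of the single terms includes positivity.
\<close>

lemma log_convex_on_nk_Bessel:
  assumes "k > 0" "x \<noteq> 0"
  shows "log_convex_on {- k<..} (\<lambda>\<nu>. nk_Bessel k \<nu> x)"
proof -
  have "log_convex_on {- k<..} (\<lambda>\<nu>. \<Sum>r. bessel_coeff k \<nu> r * x ^ (2 * r))"
  proof (rule log_convex_on_suminf)
    fix r
    show "log_convex_on {- k<..} (\<lambda>\<nu>. bessel_coeff k \<nu> r * x ^ (2 * r))"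
      unfolding bessel_coeff_def
      by (intro log_convex_on_mult log_convex_on_prod log_convex_on_inverse_affine log_convex_on_const)
         (use assms in \<open>auto simp: shifted_index_pos power_mult\<close>)
  qed (use assms in \<open>auto intro: summable_bessel\<close>)
  then show ?thesis
    by (rule log_convex_on_cong[THEN iffD1, rotated])
       (use assms in \<open>simp add: nk_Bessel_eq_suminf\<close>)
qed

lemma nk_Bessel_shift_cross_le:
  assumes "k > 0" "x \<noteq> 0" "\<mu> > - k" "\<mu> \<le> \<nu>"
  shows "nk_Bessel k \<nu> x * nk_Bessel k (\<mu> + k) x \<le> nk_Bessel k (\<nu> + k) x * nk_Bessel k \<mu> x"
proof -
  let ?J = "\<lambda>\<nu>. nk_Bessel k \<nu> x"
  have "ln (?J (\<mu> + k)) + ln (?J \<nu>) \<le> ln (?J \<mu>) + ln (?J (\<nu> + k))"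
    using log_convex_on_nk_Bessel[OF assms(1,2)] assms unfolding log_convex_on_def
    by (intro convex_on_increments_mono[of "{- k<..}"]) auto
  moreover have "?J (\<mu> + k) > 0" "?J \<nu> > 0" "?J \<mu> > 0" "?J (\<nu> + k) > 0"
    using assms by (auto intro: nk_Bessel_pos)
  ultimately have "ln (?J \<nu> * ?J (\<mu> + k)) \<le> ln (?J (\<nu> + k) * ?J \<mu>)"
    by (simp add: ln_mult)
  then show ?thesis
    using \<open>?J (\<mu> + k) > 0\<close> \<open>?J \<nu> > 0\<close> \<open>?J \<mu> > 0\<close> \<open>?J (\<nu> + k) > 0\<close> by simp
qed

lemma mono_on_nk_Bessel_shift_quotient:
  assumes "k > 0" "x \<noteq> 0"
  shows "mono_on {- k<..} (\<lambda>\<nu>. nk_Bessel k (\<nu> + k) x / nk_Bessel k \<nu> x)"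
proof (rule mono_onI)
  fix \<mu> \<nu> :: real
  assume "\<mu> \<in> {- k<..}" "\<nu> \<in> {- k<..}" "\<mu> \<le> \<nu>"
  then show "nk_Bessel k (\<mu> + k) x / nk_Bessel k \<mu> x \<le> nk_Bessel k (\<nu> + k) x / nk_Bessel k \<nu> x"
    using nk_Bessel_shift_cross_le[OF assms, of \<mu> \<nu>] nk_Bessel_pos[OF assms(1), of _ x]
    by (simp add: divide_simps mult_ac)
qed

theorem theorem3p1:
  fixes k :: real
  assumes "k > 0"
  shows "(\<forall>\<mu> \<nu>. \<mu> > - k \<and> \<nu> \<ge> \<mu> \<longrightarrow>
            mono_on {0..} (\<lambda>x. nk_Bessel k \<mu> x / nk_Bessel k \<nu> x)) \<and>
         (\<forall>x>0. mono_on {- k<..} (\<lambda>\<nu>. nk_Bessel k (\<nu> + k) x / nk_Bessel k \<nu> x) \<and>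
            (\<forall>\<mu> \<nu>. \<mu> > - k \<and> \<nu> \<ge> \<mu> \<longrightarrow>
               nk_Bessel k (\<nu> + k) x * nk_Bessel k \<mu> x \<ge>
               nk_Bessel k \<nu> x * nk_Bessel k (\<mu> + k) x)) \<and>
         (\<forall>x>0. antimono_on {- k<..} (\<lambda>\<nu>. nk_Bessel k \<nu> x) \<and>
            log_convex_on {- k<..} (\<lambda>\<nu>. nk_Bessel k \<nu> x))"
  using assms
  by (auto intro: mono_on_nk_Bessel_quotient mono_on_nk_Bessel_shift_quotient
      nk_Bessel_shift_cross_le antimono_on_nk_Bessel log_convex_on_nk_Bessel)

end
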